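(* Let $\mathfrak{c}$ denote the cardinality of the continuum. There exists a dense subgroup of $\mathbb{Z}_2^{\mathfrak{c}}$ which (with the subspace topology) is selectively pseudocompact (equivalently, strongly pseudocompact) but not selectively sequentially pseudocompact.
   Context: $\mathbb{Z}_2$ is the two-element group with the discrete topology, and powers of $\mathbb{Z}_2$ carry the product topology. For a free (non-principal) ultrafilter $p$ on $\mathbb{N}$, a point $x$ of a space $X$ is a $p$-limit of a sequence $\{x_n:n\in\mathbb{N}\}$ of points of $X$ if $\{n\in\mathbb{N}:x_n\in V\}\in p$ for every neighbourhood $V$ of $x$ in $X$. A space $X$ is selectively pseudocompact (also called strongly pseudocompact; the two names denote the same property) if for every sequence $\{U_n:n\in\mathbb{N}\}$ of non-empty open subsets of $X$ one can choose a point $x_n\in U_n$ for each $n\in\mathbb{N}$ in such a way that the sequence $\{x_n:n\in\mathbb{N}\}$ has a $p$-limit in $X$ for some free ultrafilter $p$ on $\mathbb{N}$ (depending on the sequence $\{U_n:n\in\mathbb{N}\}$). A space $X$ is selectively sequentially pseudocompact if for every sequence $\{U_n:n\in\mathbb{N}\}$ of non-empty open subsets of $X$ one can choose a point $x_n\in U_n$ for each $n\in\mathbb{N}$ in such a way that the sequence $\{x_n:n\in\mathbb{N}\}$ has a subsequence converging to a point of $X$. *)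

theory Defs
  imports "HOL-Analysis.Analysis" "HOL-Algebra.Elementary_Groups" "HOL-Algebra.Product_Groups"
begin

text \<open>An ultrafilter on \<open>\<nat>\<close> is a \<^typ>\<open>nat filter\<close>; a set \<open>A\<close> belongs to \<open>p\<close> iff
  \<open>eventually (\<lambda>n. n \<in> A) p\<close>. Since \<^typ>\<open>nat filter\<close> contains the improper filter \<^term>\<open>bot\<close>,
  properness is required explicitly. The principal ultrafilters are those of the form
  \<open>principal {k}\<close>.\<close>

definition free_ultrafilter :: "nat filter \<Rightarrow> bool" where
  "free_ultrafilter p \<longleftrightarrow>
     p \<noteq> bot \<and>
     (\<forall>A. eventually (\<lambda>n. n \<in> A) p \<or> eventually (\<lambda>n. n \<notin> A) p) \<and>
     (\<forall>k. p \<noteq> principal {k})"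

text \<open>For an ultrafilter \<open>p\<close>, \<open>limitin X x l p\<close> says that \<open>l\<close> is a \<open>p\<close>-limit of \<open>x\<close> in \<open>X\<close>.
  The property below is also known as strong pseudocompactness.\<close>

definition selectively_pseudocompact :: "'a topology \<Rightarrow> bool" where
  "selectively_pseudocompact X \<longleftrightarrow>
     (\<forall>U :: nat \<Rightarrow> 'a set. (\<forall>n. openin X (U n) \<and> U n \<noteq> {}) \<longrightarrow>
        (\<exists>x. (\<forall>n. x n \<in> U n) \<and> (\<exists>p l. free_ultrafilter p \<and> limitin X x l p)))"

definition selectively_sequentially_pseudocompact :: "'a topology \<Rightarrow> bool" where
  "selectively_sequentially_pseudocompact X \<longleftrightarrow>
     (\<forall>U :: nat \<Rightarrow> 'a set. (\<forall>n. openin X (U n) \<and> U n \<noteq> {}) \<longrightarrow>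
        (\<exists>x. (\<forall>n. x n \<in> U n) \<and>
             (\<exists>(r :: nat \<Rightarrow> nat) l. strict_mono r \<and> limitin X (x \<circ> r) l sequentially)))"

text \<open>The group \<open>\<int>\<^sub>2\<^sup>I\<close> and its product topology; both live on the extensional functions
  \<open>I \<rightarrow>\<^sub>E {0, 1}\<close>.\<close>

definition Z2_power :: "'i set \<Rightarrow> ('i \<Rightarrow> int) monoid" where
  "Z2_power I = product_group I (\<lambda>_. integer_mod_group 2)"

definition Z2_power_topology :: "'i set \<Rightarrow> ('i \<Rightarrow> int) topology" where
  "Z2_power_topology I =
     product_topology (\<lambda>_. discrete_topology (carrier (integer_mod_group 2))) I"

lemma topspace_Z2_power_topology: "topspace (Z2_power_topology I) = carrier (Z2_power I)"
  by (simp add: Z2_power_topology_def Z2_power_def)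

lemma carrier_Z2_power: "carrier (Z2_power I) = (\<Pi>\<^sub>E i\<in>I. {0, 1})"
proof -
  have "{0..<2::int} = {0, 1}" by auto
  then show ?thesis by (simp add: Z2_power_def carrier_integer_mod_group)
qed

end

theory Submission
  imports Defs
begin

text \<open>The group is generated by points \<open>x a n\<close> and \<open>y a = p-lim x a n\<close>, where \<open>a\<close> runs over all
  sequences of basic open sets and \<open>x a n\<close> is chosen in the \<open>n\<close>-th set of \<open>a\<close>; this alone forces
  density and selective pseudocompactness. A basic open set restricts only finitely many
  coordinates, so at every other coordinate \<open>r\<close> the bits \<open>x a n r\<close> may be prescribed freely: they are
  the indicator of a countable set \<open>g r\<close> of pairs \<open>(a, n)\<close>, with \<open>g\<close> attaining each countable
  set uncountably often. A sequence of distinct elements involves countably many \<open>a\<close>, and some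
  countable set of generators makes the sequence alternate infinitely often at the coordinates
  where it is prescribed; one of these is unrestricted for all the \<open>a\<close> involved. Hence no sequence of
  distinct elements converges, while points chosen from disjoint open sets are distinct.\<close>

section \<open>Free ultrafilters on the naturals\<close>

text \<open>Zorn's lemma yields a minimal proper filter below \<open>F\<close>. It decides every
  \<open>P\<close>: unless the negation already holds eventually, adding \<open>P\<close> keeps the
  filter proper, so by minimality \<open>P\<close> was there.\<close>

lemma ultrafilter_below:
  assumes "F \<noteq> bot"
  shows "\<exists>p\<le>F. p \<noteq> bot \<and> (\<forall>P. eventually P p \<or> eventually (\<lambda>x. \<not> P x) p)"
proof -
  define A where "A = {p. p \<le> F \<and> p \<noteq> bot}"
  have "\<exists>p\<in>A. \<forall>q\<in>A. p \<ge> q \<longrightarrow> q = p"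
  proof (rule predicate_Zorn)
    show "partial_order_on A (relation_of (\<ge>) A)"
      by (rule partial_order_on_relation_ofI) auto
  next
    fix C assume C: "C \<in> Chains (relation_of (\<ge>) A)"
    have CA: "C \<subseteq> A" and lin: "\<And>p q. p \<in> C \<Longrightarrow> q \<in> C \<Longrightarrow> p \<le> q \<or> q \<le> p"
      using C by (auto simp: Chains_def relation_of_def)
    show "\<exists>u\<in>A. \<forall>a\<in>C. u \<le> a"
    proof (cases "C = {}")
      case True
      then show ?thesis using assms by (auto simp: A_def)
    next
      case False
      \<comment> \<open>A nonempty chain is a filter base, so whatever holds along
        \<open>Inf C\<close> holds along a member; hence \<open>Inf C\<close> stays proper.\<close>
      have "eventually P (Inf C) \<longleftrightarrow> (\<exists>b\<in>C. eventually P b)" for P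
        by (rule eventually_Inf_base[OF False]) (metis lin inf.absorb1 inf.absorb2 order_refl)
      then have "Inf C \<noteq> bot"
        using CA by (auto simp: A_def trivial_limit_def)
      moreover have "Inf C \<le> F"
        using False CA by (auto simp: A_def intro: Inf_lower2)
      ultimately have "Inf C \<in> A" by (simp add: A_def)
      then show ?thesis by (meson Inf_lower)
    qed
  qed
  then obtain p where p: "p \<in> A" and min: "\<And>q. q \<in> A \<Longrightarrow> q \<le> p \<Longrightarrow> q = p" by blast
  have "eventually P p" if "\<not> eventually (\<lambda>x. \<not> P x) p" for P
  proof -
    have "inf p (principal (Collect P)) \<noteq> bot"
      using that by (simp add: trivial_limit_def eventually_inf_principal)
    then have "inf p (principal (Collect P)) \<in> A"
      using p by (auto simp: A_def intro: le_infI1)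
    then have "inf p (principal (Collect P)) = p" by (intro min) auto
    then have "eventually P p \<longleftrightarrow> eventually P (inf p (principal (Collect P)))" by simp
    then show ?thesis by (simp add: eventually_inf_principal)
  qed
  then show ?thesis using p unfolding A_def by blast
qed

text \<open>An ultrafilter finer than \<open>sequentially\<close> contains every final segment, so
  it is not concentrated at a point.\<close>

lemma free_ultrafilter_exists: "\<exists>p\<le>sequentially. free_ultrafilter p"
proof -
  obtain p :: "nat filter" where p: "p \<le> sequentially" "p \<noteq> bot"
    "\<And>P. eventually P p \<or> eventually (\<lambda>x. \<not> P x) p"
    using ultrafilter_below[of sequentially] by auto
  have "p \<noteq> principal {k}" for k
    using filter_leD[OF p(1) eventually_gt_at_top[of k]] by (auto simp: eventually_principal)
  with p show ?thesis unfolding free_ultrafilter_def by blast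
qed

section \<open>Parities of finite intersections\<close>

lemma odd_card_sym_diff:
  assumes "finite A" "finite B"
  shows "odd (card (A - B \<union> (B - A))) \<longleftrightarrow> odd (card A) \<noteq> odd (card B)"
proof -
  have "card (A - B \<union> (B - A)) = card (A - B) + card (B - A)"
    using assms by (intro card_Un_disjoint) auto
  moreover have "card A = card (A - B) + card (A \<inter> B)"
    using assms by (metis card_Int_Diff add.commute)
  moreover have "card B = card (B - A) + card (A \<inter> B)"
    using assms by (metis card_Int_Diff add.commute inf_commute)
  ultimately show ?thesis by presburger
qed

text \<open>Along a subsequence \<open>k j\<close>, each \<open>D (k j)\<close> has an element
  \<open>g j\<close> of \<open>G\<close> absent from all earlier \<open>D (k l)\<close>. Putting
  \<open>g j\<close> into \<open>B\<close> or leaving it out adjusts the parity at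
  \<open>k j\<close> without touching the earlier ones.\<close>

lemma infinite_parity_split:
  fixes D :: "nat \<Rightarrow> 'b set"
  assumes fin: "\<And>k. finite (D k)" and inf: "infinite ((\<Union>k. D k) \<inter> G)"
  shows "\<exists>B\<subseteq>G. countable B \<and> infinite {k. odd (card (D k \<inter> B))} \<and> infinite {k. even (card (D k \<inter> B))}"
proof -
  \<comment> \<open>Finitely many of the finite sets cannot exhaust the infinite part in
    \<open>G\<close>, so a new element turns up at a later index.\<close>
  have new: "\<exists>k' g'. g' \<in> D k' \<inter> G \<and> k < k' \<and> g' \<notin> (\<Union>m\<le>k. D m)" for k
  proof -
    have "\<not> (\<Union>k. D k) \<inter> G \<subseteq> (\<Union>m\<le>k. D m)"
      using inf fin by (meson finite_UN_I finite_atMost finite_subset)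
    then obtain g' k' where "g' \<in> D k' \<inter> G" "g' \<notin> (\<Union>m\<le>k. D m)" by blast
    then show ?thesis using not_less by fastforce
  qed
  have "\<exists>f. \<forall>n. snd (f n) \<in> D (fst (f n)) \<inter> G \<and>
        (fst (f n) < fst (f (Suc n)) \<and> snd (f (Suc n)) \<notin> (\<Union>m\<le>fst (f n). D m))"
    by (rule dependent_nat_choice) (use new in \<open>auto, metis IntD1 IntD2\<close>)
  then obtain f where f: "\<And>n. snd (f n) \<in> D (fst (f n)) \<inter> G" "\<And>n. fst (f n) < fst (f (Suc n))"
    "\<And>n m. m \<le> fst (f n) \<Longrightarrow> snd (f (Suc n)) \<notin> D m" by blast
  define k where "k = fst \<circ> f"
  define g where "g = snd \<circ> f"
  have k: "strict_mono k" unfolding strict_mono_Suc_iff k_def using f by auto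
  have gD: "g j \<in> D (k j)" and gG: "g j \<in> G" for j using f by (auto simp: g_def k_def)
  have gnew: "g l \<notin> D (k j)" if "j < l" for j l
  proof -
    obtain l' where "l = Suc l'" "j \<le> l'" using \<open>j < l\<close> by (cases l) auto
    then show ?thesis using f(3)[of "k j" l'] strict_mono_leD[OF k, of j l'] by (auto simp: g_def k_def)
  qed
  \<comment> \<open>Aiming at the parity of \<open>j\<close> for the count at \<open>k j\<close>
    makes both parities recur.\<close>
  define S where "S = rec_nat {} (\<lambda>j S. if odd (card (D (k j) \<inter> S)) = odd j then S else insert (g j) S)"
  have S_Suc: "S (Suc j) = (if odd (card (D (k j) \<inter> S j)) = odd j then S j else insert (g j) (S j))" for j
    by (simp add: S_def)
  have S_sub: "S j \<subseteq> g ` {..<j}" for j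
    by (induction j) (auto simp: S_Suc S_def lessThan_Suc split: if_splits)
  have S_mono: "mono S" by (intro mono_iff_le_Suc[THEN iffD2]) (auto simp: S_Suc)
  have par: "odd (card (D (k j) \<inter> S (Suc j))) = odd j" for j
  proof -
    have "g j \<noteq> g l" if "l < j" for l using gnew[OF that] gD[of l] by metis
    then have "g j \<notin> S j" using S_sub[of j] by fastforce
    then have "card (D (k j) \<inter> insert (g j) (S j)) = Suc (card (D (k j) \<inter> S j))"
      using gD fin by simp
    then show ?thesis by (auto simp: S_Suc)
  qed
  define B where "B = (\<Union>j. S j)"
  \<comment> \<open>Elements \<open>g l\<close> with \<open>l > j\<close> lie outside
    \<open>D (k j)\<close>, so stage \<open>Suc j\<close> is final there.\<close>
  have DB: "D (k j) \<inter> B = D (k j) \<inter> S (Suc j)" for j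
  proof -
    have "x \<in> S (Suc j)" if "x \<in> D (k j)" "x \<in> S l" for x l
    using that(2)
    proof (induction l)
      case 0
      then show ?case by (simp add: S_def)
    next
      case (Suc l)
      show ?case
      proof (cases "x \<in> S l")
        case False
        with Suc have "x = g l" by (auto simp: S_Suc split: if_splits)
        then have "l \<le> j" using gnew that(1) not_less by blast
        then show ?thesis using monoD[OF S_mono, of "Suc l" "Suc j"] Suc by auto
      qed (use Suc in auto)
    qed
    then show ?thesis by (auto simp: B_def)
  qed
  have infin: "infinite {i. P (card (D i \<inter> B))}" if "\<And>j. Q j \<Longrightarrow> P (card (D (k j) \<inter> B))" "infinite {j. Q j}" for P Q
  proof -
    have "infinite (k ` {j. Q j})"
      using that(2) k by (simp add: finite_image_iff strict_mono_imp_inj_on inj_on_subset)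
    then show ?thesis
      by (rule contrapos_nn) (rule finite_subset, use that in auto)
  qed
  have "B \<subseteq> range g" using S_sub unfolding B_def by blast
  then have "countable B" "B \<subseteq> G" using gG by (auto intro: countable_subset)
  moreover have "infinite {j :: nat. odd j}" "infinite {j :: nat. even j}"
    unfolding infinite_nat_iff_unbounded_le by (simp_all, presburger+)
  then have "infinite {i. odd (card (D i \<inter> B))}" "infinite {i. even (card (D i \<inter> B))}"
    using infin[of odd odd] infin[of even even] par DB by simp_all
  ultimately show ?thesis by blast
qed

section \<open>Types of size at most the continuum\<close>

text \<open>A sequence of sets of naturals is one set of pairs, hence one set of naturals.\<close>

lemma lepoll_nat_sets_fun:
  assumes "(UNIV :: 'a set) \<lesssim> (UNIV :: nat set set)"
  shows "(UNIV :: (nat \<Rightarrow> 'a) set) \<lesssim> (UNIV :: nat set set)"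
proof -
  obtain e :: "'a \<Rightarrow> nat set" where e: "inj e" using assms by (auto simp: lepoll_def)
  have "inj (\<lambda>f. {prod_encode (n, m) |n m. m \<in> e (f n)})"
  proof (rule injI)
    fix f f' assume "{prod_encode (n, m) |n m. m \<in> e (f n)} = {prod_encode (n, m) |n m. m \<in> e (f' n)}"
    then have "m \<in> e (f n) \<longleftrightarrow> m \<in> e (f' n)" for n m
      by (simp add: set_eq_iff) (metis prod_encode_eq prod.inject)
    then have "e (f n) = e (f' n)" for n by blast
    then show "f = f'" using e by (auto simp: inj_eq)
  qed
  then show ?thesis by (auto simp: lepoll_def)
qed

lemma lepoll_nat_sets_times:
  assumes "(UNIV :: 'a set) \<lesssim> (UNIV :: nat set set)" "(UNIV :: 'b set) \<lesssim> (UNIV :: nat set set)"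
  shows "(UNIV :: ('a \<times> 'b) set) \<lesssim> (UNIV :: nat set set)"
proof -
  obtain e :: "'a \<Rightarrow> nat set" where e: "inj e" using assms by (auto simp: lepoll_def)
  obtain d :: "'b \<Rightarrow> nat set" where d: "inj d" using assms by (auto simp: lepoll_def)
  have "inj (\<lambda>(x,y) n. if n = (0::nat) then e x else d y)"
  proof (rule injI, clarify)
    fix x x' y y' assume "(\<lambda>n. if n = (0::nat) then e x else d y) = (\<lambda>n. if n = 0 then e x' else d y')"
    from fun_cong[OF this, of 0] fun_cong[OF this, of 1] show "x = x' \<and> y = y'"
      by (simp add: inj_eq[OF e] inj_eq[OF d])
  qed
  then have "(UNIV :: ('a \<times> 'b) set) \<lesssim> (UNIV :: (nat \<Rightarrow> nat set) set)"
    unfolding lepoll_def by blast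
  then show ?thesis using lepoll_nat_sets_fun[OF lepoll_refl] lepoll_trans by blast
qed

lemma lepoll_nat_sets_countable: "(UNIV :: 'a :: countable set) \<lesssim> (UNIV :: nat set set)"
  unfolding lepoll_def by (rule exI[of _ "\<lambda>x. {to_nat x}"]) (auto simp: inj_def)

lemma lepoll_nat_sets_list:
  assumes "(UNIV :: 'a set) \<lesssim> (UNIV :: nat set set)"
  shows "(UNIV :: 'a list set) \<lesssim> (UNIV :: nat set set)"
proof -
  \<comment> \<open>Padding with \<open>undefined\<close> turns a list into a sequence; the recorded
    length keeps the map injective.\<close>
  have "inj (\<lambda>xs. (length xs, \<lambda>n. if n < length xs then xs ! n else undefined :: 'a))"
  proof (rule injI)
    fix xs ys :: "'a list"
    assume "(length xs, \<lambda>n. if n < length xs then xs ! n else undefined) =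
      (length ys, \<lambda>n. if n < length ys then ys ! n else undefined)"
    then have len: "length xs = length ys"
      and nth: "(if n < length xs then xs ! n else undefined) = (if n < length ys then ys ! n else undefined)" for n
      by (auto dest: fun_cong[where x = n])
    show "xs = ys"
    proof (rule nth_equalityI[OF len])
      fix i assume "i < length xs"
      then show "xs ! i = ys ! i" using nth[of i] unfolding len by simp
    qed
  qed
  then have "(UNIV :: 'a list set) \<lesssim> (UNIV :: (nat \<times> (nat \<Rightarrow> 'a)) set)"
    unfolding lepoll_def by blast
  then show ?thesis
    using lepoll_nat_sets_times[OF lepoll_nat_sets_countable lepoll_nat_sets_fun[OF assms]] lepoll_trans by blast
qed

lemma lepoll_nat_sets_option:
  assumes "(UNIV :: 'a set) \<lesssim> (UNIV :: nat set set)"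
  shows "(UNIV :: 'a option set) \<lesssim> (UNIV :: nat set set)"
proof -
  have "inj (\<lambda>x :: 'a option. case x of None \<Rightarrow> [] | Some y \<Rightarrow> [y])"
    by (rule injI) (auto split: option.splits)
  then have "(UNIV :: 'a option set) \<lesssim> (UNIV :: 'a list set)"
    unfolding lepoll_def by blast
  then show ?thesis using lepoll_nat_sets_list[OF assms] lepoll_trans by blast
qed

text \<open>Let \<open>r\<close> code an enumeration together with a set of naturals. Since
  \<open>g\<close> reads only the enumeration, each countable set has uncountably many codes, more
  than \<open>A\<close> can contain.\<close>

lemma uncountably_often_surj:
  assumes "(UNIV :: 'a set) \<lesssim> (UNIV :: nat set set)"
  shows "\<exists>g :: nat set \<Rightarrow> 'a set. \<forall>C A. countable C \<longrightarrow> countable A \<longrightarrow> (\<exists>r. r \<notin> A \<and> g r = C)"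
proof -
  have "(UNIV :: ((nat \<Rightarrow> 'a option) \<times> nat set) set) \<lesssim> (UNIV :: nat set set)"
    by (intro lepoll_nat_sets_times lepoll_nat_sets_fun lepoll_nat_sets_option assms lepoll_refl)
  then obtain enc :: "(nat \<Rightarrow> 'a option) \<times> nat set \<Rightarrow> nat set" where enc: "inj enc"
    by (auto simp: lepoll_def)
  define g where "g r = {c. Some c \<in> range (fst (inv_into UNIV enc r))}" for r
  have "\<exists>r. r \<notin> A \<and> g r = C" if "countable C" "countable A" for C A
  proof -
    \<comment> \<open>Terms equal to \<open>None\<close> allow the enumerated set to be
      empty.\<close>
    obtain f :: "nat \<Rightarrow> 'a option" where f: "{c. Some c \<in> range f} = C"
    proof (cases "C = {}")
      case True
      then show thesis using that[of "\<lambda>_. None"] by auto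
    next
      case False
      have "{c. Some c \<in> range (\<lambda>n. Some (from_nat_into C n))} = range (from_nat_into C)" by auto
      then show thesis using that[of "\<lambda>n. Some (from_nat_into C n)"] range_from_nat_into[OF False \<open>countable C\<close>] by simp
    qed
    have "uncountable (UNIV :: nat set set)"
      using nat_sets_eqpoll_reals countable_eqpoll eqpoll_sym uncountable_UNIV_real by blast
    moreover have "inj (\<lambda>y. enc (f, y))" using enc by (auto simp: inj_def)
    ultimately have "uncountable (range (\<lambda>y. enc (f, y)))"
      by (simp add: countable_image_inj_eq)
    then obtain y where "enc (f, y) \<notin> A"
      using \<open>countable A\<close> by (meson countable_subset image_subsetI)
    then show ?thesis using f by (intro exI[of _ "enc (f, y)"]) (simp add: g_def enc)
  qed
  then show ?thesis by blast
qed

section \<open>Prescribing parities compatibly with limits along an ultrafilter\<close>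

lemma free_not_eventually_singleton:
  assumes "p \<noteq> bot" "p \<le> sequentially"
  shows "\<not> eventually (\<lambda>n. n = k) p"
proof
  assume "eventually (\<lambda>n. n = k) p"
  moreover have "eventually (\<lambda>n. n > k) p"
    using filter_leD[OF assms(2) eventually_gt_at_top] .
  ultimately have "eventually (\<lambda>n. False) p" by eventually_elim auto
  then show False using assms(1) by (simp add: trivial_limit_def)
qed

text \<open>If some \<open>n\<close> has an infinite fibre, its singleton is not in
  \<open>p\<close>. Otherwise infinitely many \<open>n\<close> occur, and they split into two
  disjoint infinite sets, of which \<open>p\<close> contains at most one.\<close>

lemma infinite_fibre_outside:
  fixes p :: "nat filter" and X :: "('a \<times> nat) set"
  assumes p: "p \<noteq> bot" "p \<le> sequentially" and X: "infinite X"
  shows "\<exists>Q. \<not> eventually (\<lambda>n. n \<in> Q) p \<and> infinite {x \<in> X. snd x \<in> Q}"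
proof (cases "\<exists>n. infinite {x \<in> X. snd x = n}")
  case True
  then obtain n where "infinite {x \<in> X. snd x \<in> {n}}" by auto
  moreover have "\<not> eventually (\<lambda>m. m \<in> {n}) p"
    using free_not_eventually_singleton[OF p] by simp
  ultimately show ?thesis by blast
next
  case False
  define N where "N = snd ` X"
  have "X = (\<Union>n\<in>N. {x \<in> X. snd x = n})" by (auto simp: N_def)
  with False X have N: "infinite N" by (metis (no_types, lifting) finite_UN_I)
  define E where "E b = enumerate N ` {j. even j = b}" for b
  have inf: "infinite {j :: nat. odd j}" "infinite {j :: nat. even j}"
    unfolding infinite_nat_iff_unbounded_le by (simp_all, presburger+)
  have E: "infinite (E b)" "E b \<subseteq> N" for b
  proof -
    have "inj_on (enumerate N) S" for S
      using strict_mono_enumerate[OF N] strict_mono_imp_inj_on inj_on_subset by blast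
    moreover have "infinite {j :: nat. even j = b}" using inf by (cases b) auto
    ultimately show "infinite (E b)" unfolding E_def by (simp add: finite_image_iff)
    show "E b \<subseteq> N" unfolding E_def using enumerate_in_set[OF N] by blast
  qed
  have disj: "E True \<inter> E False = {}"
    using strict_mono_enumerate[OF N] strict_mono_eq unfolding E_def by fastforce
  have "\<not> (eventually (\<lambda>n. n \<in> E True) p \<and> eventually (\<lambda>n. n \<in> E False) p)"
  proof
    assume "eventually (\<lambda>n. n \<in> E True) p \<and> eventually (\<lambda>n. n \<in> E False) p"
    then have "eventually (\<lambda>n. n \<in> E True \<inter> E False) p" by (auto intro: eventually_conj)
    then show False using p(1) unfolding disj by (simp add: trivial_limit_def)
  qed
  then obtain b where b: "\<not> eventually (\<lambda>n. n \<in> E b) p" by blast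
  have "E b \<subseteq> snd ` {x \<in> X. snd x \<in> E b}" using E(2)[of b] by (auto simp: N_def)
  then have "infinite {x \<in> X. snd x \<in> E b}"
    using E(1)[of b] by (meson finite_imageI finite_subset)
  with b show ?thesis by blast
qed

text \<open>The generator \<open>x a n\<close> is encoded as \<open>(a, Some n)\<close> and its \<open>p\<close>-limit \<open>y a\<close> as \<open>(a, None)\<close>;
  a homomorphism given on the \<open>x a n\<close> takes the forced value at \<open>y a\<close>.\<close>

definition p_extend :: "nat filter \<Rightarrow> ('a \<times> nat \<Rightarrow> bool) \<Rightarrow> 'a \<times> nat option \<Rightarrow> bool" where
  "p_extend p v c = (case snd c of None \<Rightarrow> eventually (\<lambda>n. v (fst c, n)) p | Some n \<Rightarrow> v (fst c, n))"

lemma p_extend_simps [simp]: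
  "p_extend p v (a, None) = eventually (\<lambda>n. v (a, n)) p"
  "p_extend p v (a, Some n) = v (a, n)"
  by (simp_all add: p_extend_def)

text \<open>\<open>C\<close> is to be the set of \<open>x a n\<close> with bit 1 at an unrestricted
  coordinate. The parities are then the bits of the elements coded by \<open>D k\<close>, which
  cannot converge there. Either infinitely many \<open>x a n\<close> occur, or infinitely many
  \<open>y a\<close> do.\<close>

lemma p_extend_parity_split:
  fixes D :: "nat \<Rightarrow> ('a \<times> nat option) set"
  assumes p: "p \<noteq> bot" "p \<le> sequentially"
    and fin: "\<And>k. finite (D k)" and inf: "infinite (\<Union>k. D k)"
  shows "\<exists>C. countable C \<and> infinite {k. odd (card {c \<in> D k. p_extend p (\<lambda>x. x \<in> C) c})} \<and>
    infinite {k. even (card {c \<in> D k. p_extend p (\<lambda>x. x \<in> C) c})}"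
proof -
  define X where "X = {x. (fst x, Some (snd x)) \<in> (\<Union>k. D k)}"
  \<comment> \<open>\<open>B\<close> is the set of codes meant to get value 1; \<open>C\<close> has
    to induce it on all codes that occur.\<close>
  have "\<exists>B C. countable C \<and> infinite {k. odd (card (D k \<inter> B))} \<and> infinite {k. even (card (D k \<inter> B))} \<and>
    (\<forall>k. \<forall>c\<in>D k. p_extend p (\<lambda>x. x \<in> C) c \<longleftrightarrow> c \<in> B)"
  proof (cases "finite X")
    case False
    \<comment> \<open>Use only generators \<open>x a n\<close> with \<open>n\<close> in a set outside \<open>p\<close>, so that all the limits vanish.\<close>
    obtain Q where Q: "\<not> eventually (\<lambda>n. n \<in> Q) p" "infinite {x \<in> X. snd x \<in> Q}"
      using infinite_fibre_outside[OF p False] by blast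
    define G where "G = {c :: 'a \<times> nat option. \<exists>n\<in>Q. snd c = Some n}"
    have "inj_on (\<lambda>x. (fst x, Some (snd x))) {x \<in> X. snd x \<in> Q}"
      by (auto intro!: inj_onI prod_eqI)
    then have "infinite ((\<lambda>x. (fst x, Some (snd x))) ` {x \<in> X. snd x \<in> Q})"
      using Q(2) finite_imageD by blast
    moreover have "(\<lambda>x. (fst x, Some (snd x))) ` {x \<in> X. snd x \<in> Q} \<subseteq> (\<Union>k. D k) \<inter> G"
      by (auto simp: X_def G_def)
    ultimately have "infinite ((\<Union>k. D k) \<inter> G)" using finite_subset by blast
    from infinite_parity_split[OF fin this] obtain B where B: "B \<subseteq> G" "countable B"
      "infinite {k. odd (card (D k \<inter> B))}" "infinite {k. even (card (D k \<inter> B))}"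
      by (elim exE conjE)
    define C where "C = {x. (fst x, Some (snd x)) \<in> B}"
    have "C \<subseteq> (\<lambda>c. (fst c, the (snd c))) ` B"
    proof
      fix x assume "x \<in> C"
      then show "x \<in> (\<lambda>c. (fst c, the (snd c))) ` B"
        by (intro image_eqI[of _ _ "(fst x, Some (snd x))"]) (simp_all add: C_def)
    qed
    then have "countable C" using B(2) countable_subset by blast
    moreover have "p_extend p (\<lambda>x. x \<in> C) c \<longleftrightarrow> c \<in> B" for c
    proof (cases c)
      case (Pair a m)
      show ?thesis
      proof (cases m)
        case None
        have "\<not> eventually (\<lambda>n. (a, n) \<in> C) p"
          by (rule contrapos_nn[OF Q(1)], erule eventually_mono) (use B(1) in \<open>auto simp: C_def G_def\<close>)
        moreover have "(a, None) \<notin> B" using B(1) by (auto simp: G_def)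
        ultimately show ?thesis using Pair None by simp
      qed (simp add: Pair C_def)
    qed
    ultimately show ?thesis using B by blast
  next
    case True
    \<comment> \<open>Prescribe the limits, and annihilate the finitely many \<open>x a n\<close> that occur.\<close>
    define G where "G = {c :: 'a \<times> nat option. snd c = None}"
    have "(\<Union>k. D k) \<subseteq> ((\<Union>k. D k) \<inter> G) \<union> (\<lambda>x. (fst x, Some (snd x))) ` X"
    proof
      fix c assume c: "c \<in> (\<Union>k. D k)"
      show "c \<in> ((\<Union>k. D k) \<inter> G) \<union> (\<lambda>x. (fst x, Some (snd x))) ` X"
      proof (cases "snd c")
        case (Some n)
        then have "c = (fst (fst c, n), Some (snd (fst c, n)))" by (simp add: prod_eq_iff)
        moreover from this c have "(fst c, n) \<in> X" by (simp add: X_def)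
        ultimately show ?thesis by blast
      qed (use c in \<open>simp add: G_def\<close>)
    qed
    then have "infinite ((\<Union>k. D k) \<inter> G)"
      using True inf by (meson finite_UnI finite_imageI finite_subset)
    from infinite_parity_split[OF fin this] obtain B where B: "B \<subseteq> G" "countable B"
      "infinite {k. odd (card (D k \<inter> B))}" "infinite {k. even (card (D k \<inter> B))}"
      by (elim exE conjE)
    define C where "C = {x. (fst x, None) \<in> B \<and> x \<notin> X}"
    have "a \<in> fst ` B" if "(a, n) \<in> C" for a n
    proof (rule image_eqI)
      show "(a, None) \<in> B" using that by (simp add: C_def)
    qed simp
    then have "C \<subseteq> fst ` B \<times> UNIV" by auto
    then have "countable C" by (rule countable_subset) (use B(2) in simp)
    moreover have "p_extend p (\<lambda>x. x \<in> C) c \<longleftrightarrow> c \<in> B" if c: "c \<in> D k" for c k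
    proof (cases c)
      case (Pair a m)
      show ?thesis
      proof (cases m)
        case None
        \<comment> \<open>For fixed \<open>a\<close>, removing \<open>X\<close> affects only
          finitely many \<open>n\<close>, which \<open>p\<close> ignores, so the limit keeps its
          prescribed value.\<close>
        have "finite {n. (a, n) \<in> X}"
          using finite_vimageI[OF True, of "Pair a"] by (simp add: inj_def vimage_def)
        then obtain k where "{n. (a, n) \<in> X} \<subseteq> {..<k}" using finite_nat_bounded by blast
        then have "(a, n) \<notin> X" if "n \<ge> k" for n using that by fastforce
        then have "eventually (\<lambda>n. (a, n) \<in> C \<longleftrightarrow> (a, None) \<in> B) p"
          by (intro eventually_mono[OF filter_leD[OF p(2) eventually_ge_at_top[of k]]]) (simp add: C_def)
        then have "eventually (\<lambda>n. (a, n) \<in> C) p \<longleftrightarrow> eventually (\<lambda>n. (a, None) \<in> B) p"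
          by (rule eventually_subst)
        then show ?thesis using p(1) Pair None by (simp add: eventually_const_iff)
      next
        case (Some n)
        then have "c \<notin> B" "(a, n) \<in> X" using B(1) c Pair by (auto simp: G_def X_def)
        then show ?thesis using Pair Some by (simp add: C_def)
      qed
    qed
    ultimately show ?thesis using B by blast
  qed
  then obtain B C where C: "countable C" "infinite {k. odd (card (D k \<inter> B))}" "infinite {k. even (card (D k \<inter> B))}"
    and BC: "\<And>k c. c \<in> D k \<Longrightarrow> p_extend p (\<lambda>x. x \<in> C) c \<longleftrightarrow> c \<in> B" by blast
  have "{c \<in> D k. p_extend p (\<lambda>x. x \<in> C) c} = D k \<inter> B" for k
    using BC by blast
  then show ?thesis using C by auto
qed

section \<open>Basic open sets of the power\<close>

lemma Z2_power_box_nbhd: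
  assumes V: "openin (Z2_power_topology I) V" and z: "z \<in> V"
  obtains F where "finite F" "F \<subseteq> I"
    "\<And>w. w \<in> carrier (Z2_power I) \<Longrightarrow> (\<And>i. i \<in> F \<Longrightarrow> w i = z i) \<Longrightarrow> w \<in> V"
proof -
  obtain U where U: "finite {i \<in> I. U i \<noteq> topspace (discrete_topology (carrier (integer_mod_group 2)))}"
      "z \<in> Pi\<^sub>E I U" "Pi\<^sub>E I U \<subseteq> V"
    using V z unfolding Z2_power_topology_def openin_product_topology_alt by blast
  show thesis
  proof (rule that[OF U(1)])
    fix w assume w: "w \<in> carrier (Z2_power I)"
      and eq: "\<And>i. i \<in> {i \<in> I. U i \<noteq> topspace (discrete_topology (carrier (integer_mod_group 2)))} \<Longrightarrow> w i = z i"
    have "w i \<in> U i" if "i \<in> I" for i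
    proof (cases "U i = carrier (integer_mod_group 2)")
      case True
      then show ?thesis using w that by (auto simp: Z2_power_def PiE_iff)
    next
      case False
      then show ?thesis using eq[of i] U(2) that by (auto simp: PiE_iff)
    qed
    then have "w \<in> Pi\<^sub>E I U" using w by (simp add: Z2_power_def PiE_iff)
    then show "w \<in> V" using U(3) by blast
  qed auto
qed

text \<open>With \<open>F\<close> the set of earlier coordinates in a sequence, these sets are
  pairwise disjoint, so points chosen from them are distinct.\<close>

lemma openin_Z2_power_one_zeros:
  assumes "i \<in> I" "finite F" "F \<subseteq> I"
  shows "openin (Z2_power_topology I) {w \<in> carrier (Z2_power I). w i = 1 \<and> (\<forall>j\<in>F. w j = 0)}"
proof -
  have "{w \<in> carrier (Z2_power I). w i = 1 \<and> (\<forall>j\<in>F. w j = 0)} =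
      Pi\<^sub>E I (\<lambda>k. {b \<in> {0, 1}. (k = i \<longrightarrow> b = 1) \<and> (k \<in> F \<longrightarrow> b = 0)})"
    using assms by (auto simp: carrier_Z2_power PiE_iff extensional_def)
  moreover have "finite {k \<in> I. {b \<in> {0, 1}. (k = i \<longrightarrow> b = 1) \<and> (k \<in> F \<longrightarrow> b = 0)} \<noteq> {0, 1 :: int}}"
    by (rule finite_subset[of _ "insert i F"]) (use assms in auto)
  moreover have "carrier (integer_mod_group 2) = {0, 1}"
    by (auto simp: carrier_integer_mod_group)
  ultimately show ?thesis
    unfolding Z2_power_topology_def by (simp add: openin_PiE_gen) blast
qed

text \<open>A sequence of basic open sets: the \<open>n\<close>-th list prescribes bits at finitely many coordinates,
  read with \<^const>\<open>map_of\<close>, so that inconsistent lists do no harm.\<close>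

type_synonym condition = "nat \<Rightarrow> (nat set \<times> bool) list"

section \<open>The subgroup and its properties\<close>

text \<open>Labelling coordinates by \<open>e\<close> lets conditions and \<open>g\<close> live on
  the fixed type \<open>nat set\<close>, whatever the index set.\<close>

locale dense_subgroup_construction =
  fixes I :: "'i set" and e :: "'i \<Rightarrow> nat set" and p :: "nat filter"
    and g :: "nat set \<Rightarrow> (condition \<times> nat) set"
  assumes e: "bij_betw e I UNIV"
    and p: "free_ultrafilter p" "p \<le> sequentially"
    and g: "\<And>C A. countable C \<Longrightarrow> countable A \<Longrightarrow> \<exists>r. r \<notin> A \<and> g r = C"
begin

definition val :: "nat set \<Rightarrow> condition \<times> nat \<Rightarrow> bool" where
  "val r c = (case map_of (fst c (snd c)) r of Some b \<Rightarrow> b | None \<Rightarrow> c \<in> g r)"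

text \<open>The sum of the generators coded in \<open>D\<close>. Every element is its own inverse,
  so sets of codes, without multiplicities, give all sums.\<close>

definition elem :: "(condition \<times> nat option) set \<Rightarrow> 'i \<Rightarrow> int" where
  "elem D = (\<lambda>i\<in>I. of_bool (odd (card {c \<in> D. p_extend p (val (e i)) c})))"

definition H :: "('i \<Rightarrow> int) set" where "H = elem ` {D. finite D}"

lemma p_not_bot: "p \<noteq> bot" using p(1) by (simp add: free_ultrafilter_def)

lemma p_ultra: "eventually P p \<or> eventually (\<lambda>n. \<not> P n) p"
proof -
  have "eventually (\<lambda>n. n \<in> Collect P) p \<or> eventually (\<lambda>n. n \<notin> Collect P) p"
    using p(1) unfolding free_ultrafilter_def by blast
  then show ?thesis by simp
qed

lemma elem_carrier: "elem D \<in> carrier (Z2_power I)"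
  by (simp add: elem_def carrier_Z2_power)

lemma elem_singleton: "i \<in> I \<Longrightarrow> elem {c} i = of_bool (p_extend p (val (e i)) c)"
proof -
  assume "i \<in> I"
  moreover have "{c' \<in> {c}. p_extend p (val (e i)) c'} = (if p_extend p (val (e i)) c then {c} else {})"
    by auto
  ultimately show ?thesis by (simp add: elem_def)
qed

lemma elem_mult:
  assumes "finite D" "finite D'"
  shows "elem D \<otimes>\<^bsub>Z2_power I\<^esub> elem D' = elem (D - D' \<union> (D' - D))"
proof -
  have "elem (D - D' \<union> (D' - D)) i = (elem D i + elem D' i) mod 2" if "i \<in> I" for i
  proof -
    let ?S = "\<lambda>D. {c \<in> D. p_extend p (val (e i)) c}"
    have "?S (D - D' \<union> (D' - D)) = ?S D - ?S D' \<union> (?S D' - ?S D)" by auto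
    then have "odd (card (?S (D - D' \<union> (D' - D)))) \<longleftrightarrow> odd (card (?S D)) \<noteq> odd (card (?S D'))"
      using odd_card_sym_diff[of "?S D" "?S D'"] assms by simp
    then show ?thesis using that by (simp add: elem_def)
  qed
  then show ?thesis by (auto simp: Z2_power_def elem_def)
qed

lemma elem_empty: "elem {} = \<one>\<^bsub>Z2_power I\<^esub>"
  by (simp add: elem_def Z2_power_def)

lemma subgroup_H: "subgroup H (Z2_power I)"
proof -
  have grp: "group (Z2_power I)" by (simp add: Z2_power_def)
  have "inv\<^bsub>Z2_power I\<^esub> elem D = elem D" if "finite D" for D
    by (rule group.inv_equality[OF grp])
      (use that in \<open>simp_all add: elem_mult elem_empty elem_carrier\<close>)
  then show ?thesis
    by (intro group.subgroupI[OF grp]) (auto simp: H_def elem_carrier elem_mult)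
qed

text \<open>Let \<open>a n\<close> record the bits of a point of \<open>V n\<close> on the finite
  support of a box around it. This entry alone ensures membership in \<open>V n\<close>, so the
  entries can be chosen independently.\<close>

lemma generic_elem:
  assumes V: "\<And>n. openin (Z2_power_topology I) (V n)" "\<And>n. V n \<noteq> {}"
  obtains a :: condition where "\<And>n. elem {(a, Some n)} \<in> V n"
proof -
  have "\<exists>xs. \<forall>a. a n = xs \<longrightarrow> elem {(a, Some n)} \<in> V n" for n
  proof -
    obtain z where z: "z \<in> V n" using V by blast
    obtain F where F: "finite F" "F \<subseteq> I"
      and box: "\<And>w. w \<in> carrier (Z2_power I) \<Longrightarrow> (\<And>i. i \<in> F \<Longrightarrow> w i = z i) \<Longrightarrow> w \<in> V n"
      using Z2_power_box_nbhd[OF V(1) z] by blast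
    have "z \<in> carrier (Z2_power I)"
      using z V(1) openin_subset topspace_Z2_power_topology by blast
    then have z01: "z i \<in> {0, 1}" if "i \<in> I" for i using that by (auto simp: carrier_Z2_power PiE_iff)
    obtain js where js: "set js = F" using finite_list[OF F(1)] by blast
    define xs where "xs = map (\<lambda>r. (r, z (inv_into I e r) = 1)) (map e js)"
    have xs: "map_of xs (e i) = Some (z i = 1)" if "i \<in> F" for i
    proof -
      have "inv_into I e (e i) = i" using e F that by (auto simp: bij_betw_def)
      moreover have "e i \<in> set (map e js)" using that js by simp
      ultimately show ?thesis unfolding xs_def by (simp only: map_of_map_restrict) simp
    qed
    have "elem {(a, Some n)} i = z i" if "a n = xs" "i \<in> F" for a i
      using z01[of i] F that xs[OF that(2)] by (auto simp: elem_singleton val_def)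
    then show ?thesis using box elem_carrier by blast
  qed
  then obtain a where "\<And>n b. b n = a n \<Longrightarrow> elem {(b, Some n)} \<in> V n" by metis
  then show thesis using that by blast
qed

text \<open>A bit of \<open>y a\<close> is the truth value along \<open>p\<close> of the bits of
  \<open>x a n\<close>; as \<open>p\<close> is an ultrafilter, these agree with it on a set in
  \<open>p\<close>.\<close>

lemma elem_p_limit:
  "limitin (Z2_power_topology I) (\<lambda>n. elem {(a, Some n)}) (elem {(a, None)}) p"
  unfolding Z2_power_topology_def limitin_componentwise
proof (intro conjI ballI)
  show "elem {(a, None)} \<in> extensional I" by (simp add: elem_def)
  have "elem D \<in> topspace (product_topology (\<lambda>_. discrete_topology (carrier (integer_mod_group 2))) I)" for D
    using elem_carrier by (simp add: Z2_power_def)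
  then show "\<forall>\<^sub>F n in p. elem {(a, Some n)} \<in> topspace (product_topology (\<lambda>_. discrete_topology (carrier (integer_mod_group 2))) I)"
    by simp
next
  fix i assume i: "i \<in> I"
  have "\<forall>\<^sub>F n in p. p_extend p (val (e i)) (a, Some n) = p_extend p (val (e i)) (a, None)"
    using p_ultra[of "\<lambda>n. val (e i) (a, n)"]
  proof
    assume *: "\<forall>\<^sub>F n in p. \<not> val (e i) (a, n)"
    have "\<not> (\<forall>\<^sub>F n in p. val (e i) (a, n))"
    proof
      assume "\<forall>\<^sub>F n in p. val (e i) (a, n)"
      with * have "\<forall>\<^sub>F n in p. False" by eventually_elim simp
      then show False using p_not_bot by (simp add: trivial_limit_def)
    qed
    with * show ?thesis by simp
  qed simp
  then have "\<forall>\<^sub>F n in p. elem {(a, Some n)} i = elem {(a, None)} i"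
    by eventually_elim (simp add: elem_singleton i del: p_extend_simps)
  moreover have "elem {(a, None)} i \<in> carrier (integer_mod_group 2)"
    using elem_carrier i by (auto simp: Z2_power_def PiE_iff)
  ultimately show "limitin (discrete_topology (carrier (integer_mod_group 2)))
      (\<lambda>n. elem {(a, Some n)} i) (elem {(a, None)} i) p"
    by (auto simp: limitin_def elim: eventually_mono)
qed

lemma dense_H: "Z2_power_topology I closure_of H = topspace (Z2_power_topology I)"
proof -
  have "H \<inter> V \<noteq> {}" if "openin (Z2_power_topology I) V" "V \<noteq> {}" for V
    using generic_elem[of "\<lambda>_. V"] that by (metis H_def IntI empty_iff finite.emptyI finite_insert imageI mem_Collect_eq)
  then show ?thesis unfolding dense_intersects_open by blast
qed

lemma elem_in_H: "finite D \<Longrightarrow> elem D \<in> H"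
  by (simp add: H_def)

text \<open>The points \<open>x a n\<close> given by a suitable \<open>a\<close> and their limit
  \<open>y a\<close> all lie in \<open>H\<close>; the same \<open>p\<close> serves every
  sequence.\<close>

lemma selectively_pseudocompact_H: "selectively_pseudocompact (subtopology (Z2_power_topology I) H)"
  unfolding selectively_pseudocompact_def
proof (intro allI impI)
  fix U :: "nat \<Rightarrow> ('i \<Rightarrow> int) set"
  assume U: "\<forall>n. openin (subtopology (Z2_power_topology I) H) (U n) \<and> U n \<noteq> {}"
  then have "\<forall>n. \<exists>V. openin (Z2_power_topology I) V \<and> U n = V \<inter> H"
    by (simp add: openin_subtopology)
  then obtain V where V: "\<And>n. openin (Z2_power_topology I) (V n)" "\<And>n. U n = V n \<inter> H" by metis
  have ne: "V n \<noteq> {}" for n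
  proof -
    have "V n \<inter> H \<noteq> {}" using U unfolding V(2)[symmetric] by simp
    then show ?thesis by blast
  qed
  obtain a where a: "\<And>n. elem {(a, Some n)} \<in> V n"
    by (rule generic_elem[of V, OF V(1) ne], rule that)
  have "limitin (subtopology (Z2_power_topology I) H) (\<lambda>n. elem {(a, Some n)}) (elem {(a, None)}) p"
    using elem_p_limit by (simp add: limitin_subtopology elem_in_H)
  then show "\<exists>x. (\<forall>n. x n \<in> U n) \<and>
      (\<exists>p l. free_ultrafilter p \<and> limitin (subtopology (Z2_power_topology I) H) x l p)"
    using a V(2) p(1) by (intro exI[of _ "\<lambda>n. elem {(a, Some n)}"]) (auto simp: elem_in_H)
qed

text \<open>At a coordinate labelled \<open>r\<close> that no condition involved restricts and with
  \<open>g r = C\<close>, the bits of \<open>elem (D k)\<close> take both values infinitely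
  often.\<close>

lemma no_injective_convergent_sequence:
  assumes D: "\<And>k. finite (D k)" and inj: "inj (\<lambda>k. elem (D k))"
  shows "\<not> limitin (Z2_power_topology I) (\<lambda>k. elem (D k)) l sequentially"
proof
  assume lim: "limitin (Z2_power_topology I) (\<lambda>k. elem (D k)) l sequentially"
  \<comment> \<open>Finitely many generators have only finitely many sums, against
    injectivity.\<close>
  have "infinite (\<Union>k. D k)"
  proof
    assume "finite (\<Union>k. D k)"
    then have "finite (elem ` Pow (\<Union>k. D k))" by simp
    moreover have "range (\<lambda>k. elem (D k)) \<subseteq> elem ` Pow (\<Union>k. D k)" by blast
    ultimately show False using inj finite_subset finite_imageD by blast
  qed
  from p_extend_parity_split[OF p_not_bot p(2) D this] obtain C where C: "countable C"
    "infinite {k. odd (card {c \<in> D k. p_extend p (\<lambda>x. x \<in> C) c})}"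
    "infinite {k. even (card {c \<in> D k. p_extend p (\<lambda>x. x \<in> C) c})}" by (elim exE conjE)
  \<comment> \<open>All entries of an occurring condition count, since \<open>y a\<close> depends on
    every \<open>x a n\<close>.\<close>
  define A where "A = (\<Union>k. \<Union>c\<in>D k. \<Union>n. fst ` set (fst c n))"
  have "countable A" unfolding A_def by (intro countable_UN) (simp_all add: D countable_finite)
  then obtain r where r: "r \<notin> A" "g r = C" using g C(1) by blast
  define i where "i = inv_into I e r"
  have i: "i \<in> I" "e i = r"
    using e unfolding i_def bij_betw_def by (auto simp: inv_into_into f_inv_into_f)
  have "val r (a, n) \<longleftrightarrow> (a, n) \<in> C" if "(a, m) \<in> D k" for a m n k
  proof -
    have "r \<notin> fst ` set (a n)" using r(1) that unfolding A_def by force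
    then have "map_of (a n) r = None" by (simp add: map_of_eq_None_iff)
    then show ?thesis by (simp add: val_def r(2))
  qed
  then have "p_extend p (val r) c \<longleftrightarrow> p_extend p (\<lambda>x. x \<in> C) c" if "c \<in> D k" for c k
    using that by (cases c; cases "snd c") (auto simp: p_extend_def)
  then have "{c \<in> D k. p_extend p (val r) c} = {c \<in> D k. p_extend p (\<lambda>x. x \<in> C) c}" for k
    by blast
  then have val: "elem (D k) i = of_bool (odd (card {c \<in> D k. p_extend p (\<lambda>x. x \<in> C) c}))" for k
    using i by (simp add: elem_def)
  have "limitin (discrete_topology (carrier (integer_mod_group 2))) (\<lambda>k. elem (D k) i) (l i) sequentially"
    using lim i(1) unfolding Z2_power_topology_def limitin_componentwise by blast
  then have "l i \<in> carrier (integer_mod_group 2)"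
    and "\<And>U. U \<subseteq> carrier (integer_mod_group 2) \<Longrightarrow> l i \<in> U \<Longrightarrow> \<forall>\<^sub>F k in sequentially. elem (D k) i \<in> U"
    by (simp_all add: limitin_def)
  from this(1) this(2)[of "{l i}"] have "\<forall>\<^sub>F k in sequentially. elem (D k) i = l i" by simp
  then obtain N where N: "\<And>k. k \<ge> N \<Longrightarrow> elem (D k) i = l i"
    unfolding eventually_sequentially by blast
  obtain j where "j \<ge> N" "odd (card {c \<in> D j. p_extend p (\<lambda>x. x \<in> C) c})"
    using C(2) unfolding infinite_nat_iff_unbounded_le by blast
  moreover obtain k where "k \<ge> N" "even (card {c \<in> D k. p_extend p (\<lambda>x. x \<in> C) c})"
    using C(3) unfolding infinite_nat_iff_unbounded_le by blast
  ultimately show False using N[of j] N[of k] val[of j] val[of k] by simp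
qed

text \<open>Any selection from the disjoint sets \<open>V n\<close> is injective, so a convergent
  subsequence would be an injective convergent sequence in \<open>H\<close>.\<close>

lemma not_selectively_sequentially_pseudocompact_H:
  "\<not> selectively_sequentially_pseudocompact (subtopology (Z2_power_topology I) H)"
proof
  assume ssp: "selectively_sequentially_pseudocompact (subtopology (Z2_power_topology I) H)"
  have "infinite (UNIV :: nat set set)" by (simp add: Finite_Set.finite_set)
  then have "infinite I" using bij_betw_finite[OF e] by simp
  then obtain i :: "nat \<Rightarrow> 'i" where i: "inj i" "range i \<subseteq> I"
    using infinite_countable_subset by blast
  define V where "V n = {w \<in> carrier (Z2_power I). w (i n) = 1 \<and> (\<forall>j\<in>i ` {..<n}. w j = 0)}" for n
  have V: "openin (Z2_power_topology I) (V n)" for n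
    unfolding V_def by (rule openin_Z2_power_one_zeros) (use i in auto)
  have ne: "V n \<noteq> {}" for n
  proof -
    have "(\<lambda>k\<in>I. if k = i n then 1 else 0) \<in> V n"
      using i by (auto simp: V_def carrier_Z2_power inj_eq image_subset_iff)
    then show ?thesis by blast
  qed
  obtain a where "\<And>n. elem {(a, Some n)} \<in> V n" by (rule generic_elem[of V, OF V ne], rule that)
  then have "openin (subtopology (Z2_power_topology I) H) (V n \<inter> H) \<and> V n \<inter> H \<noteq> {}" for n
    using V elem_in_H[of "{(a, Some n)}"] by (auto simp: openin_subtopology)
  then obtain x r l where x: "\<And>n. x n \<in> V n \<inter> H" and r: "strict_mono (r :: nat \<Rightarrow> nat)"
    and lim: "limitin (subtopology (Z2_power_topology I) H) (x \<circ> r) l sequentially"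
    using ssp[unfolded selectively_sequentially_pseudocompact_def, rule_format, of "\<lambda>n. V n \<inter> H"] by blast
  have "x m \<noteq> x n" if "m < n" for m n
  proof -
    have "x m (i m) = 1" using x[of m] by (simp add: V_def)
    moreover have "x n (i m) = 0" using x[of n] that by (simp add: V_def)
    ultimately show ?thesis by auto
  qed
  then have inj: "inj x" by (intro linorder_injI)
  have "\<forall>k. \<exists>D. finite D \<and> x (r k) = elem D"
    using x unfolding H_def by blast
  then obtain D where D: "\<And>k. finite (D k)" "\<And>k. x (r k) = elem (D k)" by metis
  then have xr: "x \<circ> r = (\<lambda>k. elem (D k))" by auto
  have "inj (x \<circ> r)" using inj r by (simp add: inj_compose strict_mono_imp_inj_on)
  then show False
    using no_injective_convergent_sequence[of D l] D(1) lim
    unfolding xr by (simp add: limitin_subtopology)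
qed

end

theorem corollary1p5:
  fixes I :: "'i set"
  assumes "eqpoll I (UNIV :: real set)"
  shows "\<exists>H. subgroup H (Z2_power I) \<and>
           Z2_power_topology I closure_of H = topspace (Z2_power_topology I) \<and>
           selectively_pseudocompact (subtopology (Z2_power_topology I) H) \<and>
           \<not> selectively_sequentially_pseudocompact (subtopology (Z2_power_topology I) H)"
proof -
  have "I \<approx> (UNIV :: nat set set)"
    using assms nat_sets_eqpoll_reals eqpoll_sym eqpoll_trans by blast
  then obtain e where e: "bij_betw e I (UNIV :: nat set set)" by (auto simp: eqpoll_def)
  obtain p where p: "free_ultrafilter p" "p \<le> sequentially"
    using free_ultrafilter_exists by blast
  \<comment> \<open>A condition is a sequence of finite lists over a set of size continuum, so there
    are at most continuum many.\<close>
  have "(UNIV :: (condition \<times> nat) set) \<lesssim> (UNIV :: nat set set)"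
    by (intro lepoll_nat_sets_times lepoll_nat_sets_fun lepoll_nat_sets_list
        lepoll_nat_sets_countable lepoll_refl)
  then obtain g :: "nat set \<Rightarrow> (condition \<times> nat) set" where
    g: "\<forall>C A. countable C \<longrightarrow> countable A \<longrightarrow> (\<exists>r. r \<notin> A \<and> g r = C)"
    using uncountably_often_surj by blast
  interpret dense_subgroup_construction I e p g
    using e p g by (intro dense_subgroup_construction.intro) simp_all
  show ?thesis
    using subgroup_H dense_H selectively_pseudocompact_H not_selectively_sequentially_pseudocompact_H
    by blast
qed

end
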